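(* Let $1<p<\infty$ and let $f=h+\overline{g}:\mathbb{D}\to\mathbb{C}$ be a uniformly locally univalent, sense-preserving harmonic mapping whose dilatation $w$ belongs to $\mathcal{B}_p$ and satisfies $\|w\|<1$. If $F=\log J_f\in\widetilde{\mathcal{B}}_p$, then $$I(f):=\int_{\mathbb{D}}|S_f(z)|^p(1-|z|^2)^{2p-2}\,dA(z)<\infty.$$
   Context: $\mathbb{D}$ is the unit disk and $dA$ is Lebesgue area measure. A sense-preserving locally univalent harmonic mapping $f:\mathbb{D}\to\mathbb{C}$ is written $f=h+\overline{g}$ with $h,g$ analytic in $\mathbb{D}$, $h(0)=g(0)=0$, $h'\neq 0$ in $\mathbb{D}$; its dilatation is $w=g'/h'$, an analytic function with $|w|<1$ in $\mathbb{D}$, and its Jacobian is $J_f=|h'|^2-|g'|^2>0$. Write $\|w\|=\sup_{z\in\mathbb{D}}|w(z)|$. With $\partial_z=\frac12(\partial_x-i\partial_y)$, $\partial_{\bar z}=\frac12(\partial_x+i\partial_y)$ and $F=\log J_f$, the Schwarzian derivative of $f$ is $S_f=F_{zz}-\frac12 F_z^2$; explicitly $S_f=S_h+\frac{\overline{w}}{1-|w|^2}\big(w'\frac{h''}{h'}-w''\big)-\frac32\big(\frac{w'\overline{w}}{1-|w|^2}\big)^2$, where $S_h=(h''/h')'-\frac12(h''/h')^2$ is the classical Schwarzian. The hyperbolic distance is $d_h(z,\xi)=\frac12\log\frac{1+p(z,\xi)}{1-p(z,\xi)}$ with $p(z,\xi)=\left|\frac{z-\xi}{1-\overline{\xi}z}\right|$,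 and $D(a,\rho)$ is the hyperbolic disk of center $a$ and radius $\rho$. A function on $\mathbb{D}$ is uniformly locally univalent if there is $\rho\in(0,\infty]$ such that it is univalent on every $D(a,\rho)$, $a\in\mathbb{D}$. For $1<p<\infty$: the analytic Besov space $\mathcal{B}_p$ consists of analytic $u$ on $\mathbb{D}$ with $\int_{\mathbb{D}}|u'(z)|^p(1-|z|^2)^{p-2}dA(z)<\infty$; $\widetilde{\mathcal{B}}_p$ consists of smooth $G:\mathbb{D}\to\mathbb{C}$ with $\int_{\mathbb{D}}(|G_z(z)|+|G_{\bar z}(z)|)^p(1-|z|^2)^{p-2}dA(z)<\infty$. *)

theory Defs
  imports "HOL-Analysis.Analysis"
begin

abbreviation unit_disk :: "complex set" where
  "unit_disk \<equiv> ball 0 1"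

definition pseudo_hyp :: "complex \<Rightarrow> complex \<Rightarrow> real" where
  "pseudo_hyp z \<xi> = cmod ((z - \<xi>) / (1 - cnj \<xi> * z))"

definition hyp_dist :: "complex \<Rightarrow> complex \<Rightarrow> real" where
  "hyp_dist z \<xi> = (1/2) * ln ((1 + pseudo_hyp z \<xi>) / (1 - pseudo_hyp z \<xi>))"

definition hyp_disk :: "complex \<Rightarrow> ereal \<Rightarrow> complex set" where
  "hyp_disk a \<rho> = {z \<in> unit_disk. ereal (hyp_dist z a) < \<rho>}"

definition uniformly_locally_univalent :: "(complex \<Rightarrow> complex) \<Rightarrow> bool" where
  "uniformly_locally_univalent f \<longleftrightarrow>
     (\<exists>\<rho>::ereal. 0 < \<rho> \<and> (\<forall>a\<in>unit_disk. inj_on f (hyp_disk a \<rho>)))"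

definition partial_x :: "(complex \<Rightarrow> complex) \<Rightarrow> complex \<Rightarrow> complex" where
  "partial_x G z = frechet_derivative G (at z) 1"

definition partial_y :: "(complex \<Rightarrow> complex) \<Rightarrow> complex \<Rightarrow> complex" where
  "partial_y G z = frechet_derivative G (at z) \<i>"

definition wirt_z :: "(complex \<Rightarrow> complex) \<Rightarrow> complex \<Rightarrow> complex" where
  "wirt_z G z = (partial_x G z - \<i> * partial_y G z) / 2"

definition wirt_zbar :: "(complex \<Rightarrow> complex) \<Rightarrow> complex \<Rightarrow> complex" where
  "wirt_zbar G z = (partial_x G z + \<i> * partial_y G z) / 2"

text \<open>C-infinity smoothness on an open set: differentiable (in the real sense) with
  smooth first-order partial derivatives, coinductively.\<close>
coinductive smooth_on :: "complex set \<Rightarrow> (complex \<Rightarrow> complex) \<Rightarrow> bool" where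
  "G differentiable_on S \<Longrightarrow> smooth_on S (partial_x G) \<Longrightarrow> smooth_on S (partial_y G)
     \<Longrightarrow> smooth_on S G"

definition analytic_besov :: "real \<Rightarrow> (complex \<Rightarrow> complex) set" where
  "analytic_besov p = {u. u holomorphic_on unit_disk \<and>
     set_nn_integral lborel unit_disk
       (\<lambda>z. ennreal (cmod (deriv u z) powr p * (1 - (cmod z)\<^sup>2) powr (p - 2))) < \<infinity>}"

definition smooth_besov :: "real \<Rightarrow> (complex \<Rightarrow> complex) set" where
  "smooth_besov p = {G. smooth_on unit_disk G \<and>
     set_nn_integral lborel unit_disk
       (\<lambda>z. ennreal ((cmod (wirt_z G z) + cmod (wirt_zbar G z)) powr p
                     * (1 - (cmod z)\<^sup>2) powr (p - 2))) < \<infinity>}"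

text \<open>Sense-preserving locally univalent harmonic mapping f = h + conj g.\<close>
definition sense_pres_harmonic :: "(complex \<Rightarrow> complex) \<Rightarrow> (complex \<Rightarrow> complex) \<Rightarrow> bool" where
  "sense_pres_harmonic h g \<longleftrightarrow>
     h holomorphic_on unit_disk \<and> g holomorphic_on unit_disk \<and> h 0 = 0 \<and> g 0 = 0 \<and>
     (\<forall>z\<in>unit_disk. deriv h z \<noteq> 0 \<and> cmod (deriv g z) < cmod (deriv h z))"

definition dilatation :: "(complex \<Rightarrow> complex) \<Rightarrow> (complex \<Rightarrow> complex) \<Rightarrow> complex \<Rightarrow> complex" where
  "dilatation h g z = deriv g z / deriv h z"

definition jacobian :: "(complex \<Rightarrow> complex) \<Rightarrow> (complex \<Rightarrow> complex) \<Rightarrow> complex \<Rightarrow> real" where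
  "jacobian h g z = (cmod (deriv h z))\<^sup>2 - (cmod (deriv g z))\<^sup>2"

definition classical_schwarzian :: "(complex \<Rightarrow> complex) \<Rightarrow> complex \<Rightarrow> complex" where
  "classical_schwarzian h z =
     deriv (\<lambda>\<zeta>. deriv (deriv h) \<zeta> / deriv h \<zeta>) z
     - (1/2) * (deriv (deriv h) z / deriv h z)\<^sup>2"

definition harmonic_schwarzian :: "(complex \<Rightarrow> complex) \<Rightarrow> (complex \<Rightarrow> complex) \<Rightarrow> complex \<Rightarrow> complex" where
  "harmonic_schwarzian h g z =
     (let w = dilatation h g in
      classical_schwarzian h z
      + cnj (w z) / complex_of_real (1 - (cmod (w z))\<^sup>2)
          * (deriv w z * (deriv (deriv h) z / deriv h z) - deriv (deriv w) z)
      - (3/2) * (deriv w z * cnj (w z) / complex_of_real (1 - (cmod (w z))\<^sup>2))\<^sup>2)"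

end

theory Submission
  imports Defs "HOL-Complex_Analysis.Complex_Analysis"
begin

text \<open>With \<open>\<phi> = h''/h'\<close> and dilatation \<open>w\<close>, differentiating \<open>log J\<close> gives
  \<open>\<phi> = F\<^sub>z + cnj w * w' / (1 - |w|^2)\<close>, so \<open>\<phi>\<close> and \<open>w'\<close> both lie in \<open>L^p\<close> for the weight
  \<open>(1 - |z|^2)^(p-2)\<close>. For a holomorphic function with this property, the sub-mean value property
  of \<open>|u|^p\<close> on the disks of radius \<open>(1 - |z|)/2\<close> shows that \<open>(1 - |z|^2) |u|\<close> is bounded, and,
  together with Cauchy's estimate and Fubini, that \<open>u'\<close> lies in \<open>L^p\<close> for the weight
  \<open>(1 - |z|^2)^(2p-2)\<close>. The Schwarzian is a combination, with bounded coefficients, of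
  \<open>\<phi>'\<close>, \<open>w''\<close> and quadratic terms in \<open>\<phi>\<close> and \<open>w'\<close>; in the latter one factor is absorbed by the
  pointwise bound.\<close>

unbundle no fps_syntax

section \<open>Rotation invariance of area measure on the complex plane\<close>

text \<open>Boxes correspond to boxes with the same side lengths. The identification carries the
  invariance of measure under orthogonal maps of \<open>real^2\<close> over to
  \<open>complex\<close>.\<close>

lemma distr_lborel_vec2_complex:
  "distr lborel borel (\<lambda>v::real^2. Complex (v $ 1) (v $ 2)) = lborel"
proof (rule lborel_eqI[symmetric])
  fix l u :: complex
  assume le: "\<And>b. b \<in> Basis \<Longrightarrow> l \<bullet> b \<le> u \<bullet> b"
  define l' u' :: "real^2" where "l' = vector [Re l, Im l]" and "u' = vector [Re u, Im u]"
  have meas: "(\<lambda>v::real^2. Complex (v $ 1) (v $ 2)) \<in> borel_measurable borel"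
    by (intro borel_measurable_continuous_onI) (auto simp: Complex_eq intro!: continuous_intros)
  have vim: "(\<lambda>v::real^2. Complex (v $ 1) (v $ 2)) -` box l u = box l' u'"
    by (auto simp: l'_def u'_def mem_box_cart in_box_complex_iff forall_2)
  have "Re l \<le> Re u" "Im l \<le> Im u"
    using le[of 1] le[of \<i>] by (auto simp: Basis_complex_def)
  then have "emeasure lborel (box l' u') = ennreal ((Re u - Re l) * (Im u - Im l))"
    by (subst emeasure_lborel_box)
       (auto simp: Basis_vec_def l'_def u'_def inner_axis UNIV_2 axis_eq_axis forall_2)
  then show "emeasure (distr lborel borel (\<lambda>v::real^2. Complex (v $ 1) (v $ 2))) (box l u)
      = ennreal (\<Prod>b\<in>Basis. (u - l) \<bullet> b)"
    using meas by (simp add: emeasure_distr vim Basis_complex_def)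
qed simp

text \<open>In the coordinates \<open>T\<close> a rotation is an orthogonal map of the plane, which
  preserves measure; testing on open boxes is enough to identify a measure with
  \<open>lborel\<close>.\<close>

lemma distr_lborel_complex_rotation:
  assumes c: "cmod c = 1"
  shows "distr lborel borel ((*) c) = (lborel :: complex measure)"
proof (rule lborel_eqI[symmetric])
  fix l u :: complex
  assume le: "\<And>b. b \<in> Basis \<Longrightarrow> l \<bullet> b \<le> u \<bullet> b"
  define T :: "real^2 \<Rightarrow> complex" where "T v = Complex (v $ 1) (v $ 2)" for v
  define S :: "complex \<Rightarrow> real^2" where "S z = vector [Re z, Im z]" for z
  \<comment> \<open>The inverse rotation \<open>cnj c\<close> appears because a distribution
    measures preimages: the preimage of a box under multiplication by \<open>c\<close> is its image
    under multiplication by \<open>cnj c\<close>.\<close>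
  define R where "R v = S (cnj c * T v)" for v
  have TS: "T (S z) = z" "S (T v) = v" for z v
    by (auto simp: T_def S_def vec_eq_iff forall_2)
  have contT: "continuous_on UNIV T"
    by (auto simp: T_def Complex_eq intro!: continuous_intros)
  have measT[measurable]: "T \<in> borel_measurable borel"
    using contT by (rule borel_measurable_continuous_onI)
  have distrT: "distr lborel borel T = lborel"
    using distr_lborel_vec2_complex by (simp add: T_def[abs_def])
  have orth: "orthogonal_transformation R"
    unfolding orthogonal_transformation
  proof
    show "linear R"
      by (rule linearI) (auto simp: R_def S_def T_def vec_eq_iff forall_2 algebra_simps)
    have n: "norm v = cmod (T v)" for v
      by (simp add: T_def norm_vec_def L2_set_def sum_2 cmod_def)
    show "\<forall>v. norm (R v) = norm v"
      unfolding n by (simp add: R_def TS norm_mult c)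
  qed
  have cc: "c * (cnj c * z) = z" "cnj c * (c * z) = z" for z
    using c complex_norm_square[of c] by (auto simp: mult.assoc[symmetric] mult.commute)
  define B where "B = T -` box l u"
  have B: "B \<in> lmeasurable"
  proof (rule lmeasurable_open)
    have "B \<subseteq> S ` box l u" unfolding B_def by (metis TS(2) imageI subsetI vimageD)
    moreover have "bounded (S ` box l u)"
    proof (rule bounded_linear_image)
      show "bounded_linear S"
        by (rule linear_conv_bounded_linear[THEN iffD1], rule linearI)
           (auto simp: S_def vec_eq_iff forall_2)
    qed simp
    ultimately show "bounded B" using bounded_subset by blast
    show "open B" unfolding B_def using contT open_box by (auto simp: continuous_on_open_vimage)
  qed
  have RB: "R ` B = T -` ((*) c -` box l u)"
  proof (intro equalityI subsetI)
    fix x assume "x \<in> R ` B"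
    then obtain v where "v \<in> B" "x = R v" by blast
    then show "x \<in> T -` ((*) c -` box l u)" by (simp add: R_def TS cc B_def)
  next
    fix x assume "x \<in> T -` ((*) c -` box l u)"
    then have "S (c * T x) \<in> B" "x = R (S (c * T x))" by (auto simp: B_def TS R_def cc)
    then show "x \<in> R ` B" by blast
  qed
  have sB: "B \<in> sets borel" "R ` B \<in> sets borel"
    using measurable_sets[OF measT, of "box l u"] measurable_sets[of "\<lambda>v. c * T v" borel borel "box l u"]
    by (auto simp: RB vimage_def) (auto simp: B_def vimage_def)
  \<comment> \<open>Invariance under orthogonal maps is a statement about \<open>lebesgue\<close>;
    both sets are Borel, so it passes to \<open>lborel\<close>.\<close>
  have eq: "emeasure lborel (R ` B) = emeasure lborel B"
  proof -
    have "emeasure lebesgue (R ` B) = emeasure lebesgue B"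
      using measure_orthogonal_image[OF orth B] measurable_orthogonal_image[OF orth B] B
      by (simp add: emeasure_eq_measure2 fmeasurableD2)
    then show ?thesis using sB by simp
  qed
  have "emeasure (distr lborel borel ((*) c)) (box l u) = emeasure (distr lborel borel T) ((*) c -` box l u)"
    by (simp add: emeasure_distr distrT)
  also have "\<dots> = emeasure lborel (R ` B)"
  proof -
    have "(*) c -` box l u \<in> sets borel"
      using measurable_sets[of "\<lambda>z. c * z" borel borel "box l u"] by simp
    then show ?thesis by (simp add: emeasure_distr RB)
  qed
  also have "\<dots> = emeasure (distr lborel borel T) (box l u)"
    by (simp add: emeasure_distr eq[unfolded B_def] B_def)
  finally show "emeasure (distr lborel borel ((*) c)) (box l u) = ennreal (\<Prod>b\<in>Basis. (u - l) \<bullet> b)"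
    using le by (simp add: distrT emeasure_lborel_box)
qed simp

lemma nn_integral_lborel_rotation:
  fixes f :: "complex \<Rightarrow> ennreal"
  assumes "cmod c = 1" "f \<in> borel_measurable borel"
  shows "(\<integral>\<^sup>+ \<zeta>. f (c * \<zeta>) \<partial>lborel) = (\<integral>\<^sup>+ \<zeta>. f \<zeta> \<partial>lborel)"
  using nn_integral_distr[of "(*) c" lborel borel f] distr_lborel_complex_rotation[OF assms(1)] assms(2)
  by simp

section \<open>Sub-mean value inequalities for \<open>|u|^p\<close> and
  \<open>|u'|^p\<close>\<close>

text \<open>A convex function lies above its tangent at \<open>a\<close>. Integrated over a circle,
  this gives Jensen's inequality for the power \<open>p\<close>.\<close>

lemma powr_tangent_le:
  fixes a t p :: real
  assumes "1 \<le> p" "0 < a" "0 \<le> t"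
  shows "a powr p + p * a powr (p - 1) * (t - a) \<le> t powr p"
proof (cases "t = 0")
  case True
  \<comment> \<open>Convexity is used on the open half-line only; at \<open>t = 0\<close> the claim
    is \<open>(1 - p) * a powr p \<le> 0\<close>.\<close>
  then show ?thesis
    using assms by (simp add: powr_diff field_simps)
next
  case False
  have cv: "convex_on {0<..} (\<lambda>x::real. x powr p)"
  proof (rule f''_ge0_imp_convex)
    fix x :: real assume "x \<in> {0<..}"
    then show "((\<lambda>x. x powr p) has_real_derivative p * x powr (p - 1)) (at x)"
      "((\<lambda>x. p * x powr (p - 1)) has_real_derivative p * ((p - 1) * x powr (p - 1 - 1))) (at x)"
      "0 \<le> p * ((p - 1) * x powr (p - 1 - 1))"
      using assms by (auto intro!: derivative_eq_intros)
  qed simp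
  have "t powr p - a powr p \<ge> p * a powr (p - 1) * (t - a)"
    by (rule convex_on_imp_above_tangent[OF cv])
       (use assms False in \<open>auto intro!: derivative_eq_intros simp: interior_open\<close>)
  then show ?thesis by simp
qed

text \<open>Cauchy's formula on the unit circle for \<open>w \<mapsto> u (z + w * \<zeta>)\<close>,
  evaluated at the centre. Writing the circle as rotations of a fixed \<open>\<zeta>\<close>
  prepares the later average over \<open>\<zeta>\<close>.\<close>

lemma circle_mean_value:
  assumes hol: "u holomorphic_on ball z r" and \<zeta>: "cmod \<zeta> < r"
  shows "((\<lambda>\<theta>. u (z + cis (2 * pi * \<theta>) * \<zeta>)) has_integral u z) {0..1}"
proof -
  define v where "v w = u (z + w * \<zeta>)" for w
  have lt: "cmod w * cmod \<zeta> < r" if "cmod w \<le> 1" for w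
    using mult_right_mono[OF that, of "cmod \<zeta>"] \<zeta> by simp
  have "v holomorphic_on cball 0 1"
    unfolding v_def
    by (rule holomorphic_on_compose_gen[OF _ hol, unfolded o_def])
       (auto intro!: holomorphic_intros simp: dist_norm norm_mult lt)
  then have "((\<lambda>w. v w / (w - 0)) has_contour_integral (2 * of_real pi * \<i> * v 0)) (circlepath 0 1)"
    by (intro Cauchy_integral_circlepath_simple) auto
  then have "((\<lambda>\<theta>. v (circlepath 0 1 \<theta>) / (circlepath 0 1 \<theta> - 0)
      * vector_derivative (circlepath 0 1) (at \<theta>)) has_integral (2 * of_real pi * \<i> * v 0)) {0..1}"
    unfolding has_contour_integral .
  \<comment> \<open>The kernel \<open>1 / w\<close> cancels against the derivative of the
    parametrisation up to the constant \<open>2 * pi * \<i>\<close>.\<close>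
  then have "((\<lambda>\<theta>. (2 * of_real pi * \<i>) * v (cis (2 * pi * \<theta>)))
      has_integral (2 * of_real pi * \<i> * v 0)) {0..1}"
    unfolding vector_derivative_circlepath
    by (rule has_integral_eq[rotated]) (simp add: circlepath cis_conv_exp mult_ac)
  then have "((\<lambda>\<theta>. inverse (2 * of_real pi * \<i>) * ((2 * of_real pi * \<i>) * v (cis (2 * pi * \<theta>))))
      has_integral (inverse (2 * of_real pi * \<i>) * (2 * of_real pi * \<i> * v 0))) {0..1}"
    by (rule has_integral_mult_right)
  then have "((\<lambda>\<theta>. v (cis (2 * pi * \<theta>))) has_integral v 0) {0..1}"
    by (simp add: field_simps)
  then show ?thesis by (simp add: v_def)
qed

text \<open>Jensen's inequality applied to the mean value property, through the tangent of the power
  function at \<open>a = |u z|\<close>. The tangent needs \<open>a > 0\<close>; for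
  \<open>u z = 0\<close> the left side vanishes.\<close>

lemma powr_norm_le_circle_mean:
  assumes hol: "u holomorphic_on ball z r" and \<zeta>: "cmod \<zeta> < r" and p: "1 \<le> p"
  shows "ennreal (cmod (u z) powr p)
    \<le> (\<integral>\<^sup>+ \<theta>\<in>{0..1}. ennreal (cmod (u (z + cis (2 * pi * \<theta>) * \<zeta>)) powr p) \<partial>lborel)"
proof (cases "u z = 0")
  case False
  define V where "V \<theta> = u (z + cis (2 * pi * \<theta>) * \<zeta>)" for \<theta> :: real
  define a where "a = cmod (u z)"
  have a: "a > 0" using False by (simp add: a_def)
  have contV: "continuous_on {0..1} V"
    unfolding V_def
    by (rule continuous_on_compose2[OF holomorphic_on_imp_continuous_on[OF hol]])
       (use \<zeta> in \<open>auto simp: dist_norm norm_mult cis_conv_exp intro!: continuous_intros\<close>)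
  have "(V has_integral u z) {0..1}"
    unfolding V_def by (rule circle_mean_value[OF hol \<zeta>])
  then have uzle: "a \<le> integral {0..1} (\<lambda>\<theta>. cmod (V \<theta>))"
    unfolding a_def using contV
    by (auto simp: integral_unique intro!: order_trans[OF _ integral_norm_bound_integral[of V]]
        integrable_continuous_real continuous_intros)
  have contP: "continuous_on {0..1} (\<lambda>\<theta>. cmod (V \<theta>) powr p)"
    using contV p by (intro continuous_on_powr' continuous_intros) auto
  \<comment> \<open>The linear term integrates to \<open>p * a powr (p - 1)\<close> times the mean
    of \<open>|V|\<close> minus \<open>a\<close>, which is nonnegative by
    \<open>uzle\<close>.\<close>
  have "a powr p \<le> integral {0..1} (\<lambda>\<theta>. a powr p + p * a powr (p - 1) * (cmod (V \<theta>) - a))"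
  proof -
    have "integral {0..1} (\<lambda>\<theta>. a powr p + p * a powr (p - 1) * (cmod (V \<theta>) - a))
      = a powr p + p * a powr (p - 1) * (integral {0..1} (\<lambda>\<theta>. cmod (V \<theta>)) - a)"
    proof (rule integral_unique)
      have 1: "((\<lambda>\<theta>. cmod (V \<theta>)) has_integral integral {0..1} (\<lambda>\<theta>. cmod (V \<theta>))) {0..1}"
        using contV by (intro integrable_integral integrable_continuous_real continuous_intros)
      have 2: "((\<lambda>\<theta>::real. b) has_integral b) {0..1}" for b :: real
        using has_integral_const_real[of b 0 1] by simp
      show "((\<lambda>\<theta>. a powr p + p * a powr (p - 1) * (cmod (V \<theta>) - a)) has_integral
        a powr p + p * a powr (p - 1) * (integral {0..1} (\<lambda>\<theta>. cmod (V \<theta>)) - a)) {0..1}"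
        by (rule has_integral_add[OF 2 has_integral_mult_right[OF has_integral_diff[OF 1 2]]])
    qed
    then show ?thesis using uzle p by simp
  qed
  also have "\<dots> \<le> integral {0..1} (\<lambda>\<theta>. cmod (V \<theta>) powr p)"
    using contV contP
    by (intro integral_le integrable_continuous_real[OF contP] integrable_continuous_real
        continuous_intros powr_tangent_le p a norm_ge_zero)
  finally have "ennreal (a powr p) \<le> ennreal (integral {0..1} (\<lambda>\<theta>. cmod (V \<theta>) powr p))"
    by (rule ennreal_leI)
  also have "\<dots> = (\<integral>\<^sup>+ \<theta>\<in>{0..1}. ennreal (cmod (V \<theta>) powr p) \<partial>lborel)"
    using contP
    by (intro nn_integral_has_integral_lebesgue'[symmetric] integrable_integral integrable_continuous_real) auto
  finally show ?thesis by (simp add: V_def a_def)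
qed simp

lemma borel_measurable_powr_norm_indicator:
  fixes u :: "complex \<Rightarrow> complex"
  assumes "open S" "continuous_on S u"
  shows "(\<lambda>\<zeta>. ennreal (cmod (u \<zeta>) powr p) * indicator S \<zeta>) \<in> borel_measurable borel"
proof -
  have [measurable]: "(\<lambda>\<zeta>. indicator S \<zeta> *\<^sub>R u \<zeta>) \<in> borel_measurable borel" "S \<in> sets borel"
    using assms by (auto intro: borel_measurable_continuous_on_indicator)
  have "(\<lambda>\<zeta>. ennreal (cmod (indicator S \<zeta> *\<^sub>R u \<zeta>) powr p) * indicator S \<zeta>) \<in> borel_measurable borel"
    by measurable
  also have "(\<lambda>\<zeta>. ennreal (cmod (indicator S \<zeta> *\<^sub>R u \<zeta>) powr p) * indicator S \<zeta>)
    = (\<lambda>\<zeta>. ennreal (cmod (u \<zeta>) powr p) * indicator S \<zeta>)"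
    by (auto simp: indicator_def)
  finally show ?thesis .
qed

lemma nn_integral_complex_translate:
  fixes f :: "complex \<Rightarrow> ennreal"
  assumes "f \<in> borel_measurable borel"
  shows "(\<integral>\<^sup>+ \<zeta>. f (z + \<zeta>) \<partial>lborel) = (\<integral>\<^sup>+ \<zeta>. f \<zeta> \<partial>lborel)"
  using nn_integral_distr[of "(+) z" lborel borel f] lborel_distr_plus[of z] assms by simp

text \<open>Averaging the circle inequality over \<open>\<zeta>\<close> and exchanging the integrals, each rotation drops
  out by invariance of Lebesgue measure; this avoids polar coordinates.\<close>
lemma powr_norm_le_disk_mean:
  assumes hol: "u holomorphic_on ball z r" and r: "0 < r" and p: "1 \<le> p"
  shows "ennreal (pi * r\<^sup>2) * ennreal (cmod (u z) powr p)
    \<le> (\<integral>\<^sup>+ \<zeta>\<in>ball z r. ennreal (cmod (u \<zeta>) powr p) \<partial>lborel)"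
proof -
  define \<Phi> where "\<Phi> \<zeta> = ennreal (cmod (u \<zeta>) powr p) * indicator (ball z r) \<zeta>" for \<zeta>
  have \<Phi>[measurable]: "\<Phi> \<in> borel_measurable borel"
    unfolding \<Phi>_def
    by (intro borel_measurable_powr_norm_indicator holomorphic_on_imp_continuous_on hol) simp
  have [measurable]: "(\<lambda>x::real. cis (2 * pi * x)) \<in> borel_measurable borel"
    by (intro borel_measurable_continuous_onI continuous_intros)
  have "ennreal (pi * r\<^sup>2) * ennreal (cmod (u z) powr p)
    = (\<integral>\<^sup>+ \<zeta>\<in>ball 0 r. ennreal (cmod (u z) powr p) \<partial>(lborel :: complex measure))"
    using r by (subst nn_integral_cmult_indicator) (simp_all add: emeasure_ball unit_ball_vol_2 mult.commute)
  also have "\<dots> \<le> (\<integral>\<^sup>+ \<zeta>. (\<integral>\<^sup>+ \<theta>\<in>{0..1}. \<Phi> (z + cis (2 * pi * \<theta>) * \<zeta>) \<partial>(lborel :: real measure)) \<partial>lborel)"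
  proof (rule nn_integral_mono)
    fix \<zeta> :: complex
    show "ennreal (cmod (u z) powr p) * indicator (ball 0 r) \<zeta>
      \<le> (\<integral>\<^sup>+ \<theta>\<in>{0..1}. \<Phi> (z + cis (2 * pi * \<theta>) * \<zeta>) \<partial>(lborel :: real measure))"
    proof (cases "cmod \<zeta> < r")
      case True
      then show ?thesis
        using powr_norm_le_circle_mean[OF hol True p]
        by (simp add: \<Phi>_def dist_norm norm_mult)
    qed simp
  qed
  also have "\<dots> = (\<integral>\<^sup>+ \<theta>. (\<integral>\<^sup>+ \<zeta>. \<Phi> (z + cis (2 * pi * \<theta>) * \<zeta>) * indicator {0..1} \<theta> \<partial>lborel) \<partial>(lborel :: real measure))"
    by (rule lborel_pair.Fubini') measurable
  also have "\<dots> = (\<integral>\<^sup>+ \<theta>. (\<integral>\<^sup>+ \<zeta>. \<Phi> \<zeta> \<partial>lborel) * indicator {0..1} \<theta> \<partial>(lborel :: real measure))"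
  proof (rule nn_integral_cong)
    fix \<theta> :: real
    have "(\<integral>\<^sup>+ \<zeta>. \<Phi> (z + cis (2 * pi * \<theta>) * \<zeta>) \<partial>lborel) = (\<integral>\<^sup>+ \<zeta>. \<Phi> \<zeta> \<partial>lborel)"
      using nn_integral_lborel_rotation[of "cis (2 * pi * \<theta>)" "\<lambda>\<zeta>. \<Phi> (z + \<zeta>)"]
        nn_integral_complex_translate[OF \<Phi>, of z] by simp
    then show "(\<integral>\<^sup>+ \<zeta>. \<Phi> (z + cis (2 * pi * \<theta>) * \<zeta>) * indicator {0..1} \<theta> \<partial>lborel)
       = (\<integral>\<^sup>+ \<zeta>. \<Phi> \<zeta> \<partial>lborel) * indicator {0..1} \<theta>"
      by (subst nn_integral_multc) auto
  qed
  also have "\<dots> = (\<integral>\<^sup>+ \<zeta>. \<Phi> \<zeta> \<partial>lborel)"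
    by (subst nn_integral_cmult_indicator) auto
  finally show ?thesis by (simp add: \<Phi>_def)
qed

text \<open>Cauchy's estimate on the circle of radius \<open>r / 2\<close> about \<open>z\<close>;
  each point of that circle is the centre of a disk of radius \<open>r / 2\<close> inside
  \<open>ball z r\<close>, where the disk mean bounds \<open>|u|\<close>.\<close>

lemma powr_norm_deriv_le_disk_mean:
  assumes hol: "u holomorphic_on ball z r" and r: "0 < r" and p: "1 \<le> p"
  shows "ennreal (cmod (deriv u z) powr p)
    \<le> ennreal (4 * 2 powr p / pi * r powr (- 2 - p)) * (\<integral>\<^sup>+ \<zeta>\<in>ball z r. ennreal (cmod (u \<zeta>) powr p) \<partial>lborel)"
proof (cases "(\<integral>\<^sup>+ \<zeta>\<in>ball z r. ennreal (cmod (u \<zeta>) powr p) \<partial>lborel) = \<infinity>")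
  case True
  then show ?thesis using r by (simp add: ennreal_mult_top)
next
  case False
  define I where "I = enn2real (\<integral>\<^sup>+ \<zeta>\<in>ball z r. ennreal (cmod (u \<zeta>) powr p) \<partial>lborel)"
  have I: "(\<integral>\<^sup>+ \<zeta>\<in>ball z r. ennreal (cmod (u \<zeta>) powr p) \<partial>lborel) = ennreal I" "0 \<le> I"
    using False by (simp_all add: I_def ennreal_enn2real less_top)
  \<comment> \<open>\<open>B\<close> bounds \<open>|u|\<close> on the circle of radius
    \<open>r / 2\<close>; the 4 comes from the area \<open>pi * r^2 / 4\<close> of the smaller
    disks.\<close>
  define B where "B = (4 * I / (pi * r\<^sup>2)) powr (1 / p)"
  have "cmod (u x) \<le> B" if x: "cmod (z - x) = r / 2" for x
  proof -
    have sub: "ball x (r / 2) \<subseteq> ball z r"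
    proof
      fix y assume "y \<in> ball x (r / 2)"
      then show "y \<in> ball z r"
        using x dist_triangle[of z y x] by (simp add: dist_norm)
    qed
    have "ennreal (pi * (r / 2)\<^sup>2) * ennreal (cmod (u x) powr p)
      \<le> (\<integral>\<^sup>+ \<zeta>\<in>ball x (r / 2). ennreal (cmod (u \<zeta>) powr p) \<partial>lborel)"
      using r by (intro powr_norm_le_disk_mean holomorphic_on_subset[OF hol sub] p) simp
    also have "\<dots> \<le> ennreal I"
      unfolding I(1)[symmetric] using sub
      by (intro nn_integral_mono mult_left_mono) (auto simp: indicator_def)
    finally have "pi * (r / 2)\<^sup>2 * cmod (u x) powr p \<le> I"
      using I(2) by (simp flip: ennreal_mult)
    then have "cmod (u x) powr p \<le> 4 * I / (pi * r\<^sup>2)"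
      using r by (simp add: field_simps power2_eq_square)
    then have "(cmod (u x) powr p) powr (1 / p) \<le> B"
      unfolding B_def using p by (intro powr_mono2) auto
    then show ?thesis using p by (simp add: powr_powr)
  qed
  then have "cmod ((deriv ^^ 1) u z) \<le> fact 1 * B / (r / 2) ^ 1"
    using r by (intro Cauchy_inequality holomorphic_on_subset[OF hol]
        holomorphic_on_imp_continuous_on) auto
  then have "cmod (deriv u z) powr p \<le> (B * (2 / r)) powr p"
    using p by (intro powr_mono2) auto
  also have "\<dots> = 4 * 2 powr p / pi * r powr (- 2 - p) * I"
    using p r I(2)
    by (simp add: B_def powr_mult powr_divide powr_powr powr_diff powr_minus powr_numeral divide_simps)
  finally show ?thesis
    using I by (simp flip: ennreal_mult)
qed

section \<open>Comparison of weights and elementary power inequalities\<close>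

text \<open>On this disk \<open>1 - |z|\<close> and \<open>1 - |\<zeta>|\<close> agree up to a
  factor 2, and \<open>1 - |x|^2\<close> lies between \<open>1 - |x|\<close> and twice that. The
  factor 4 would do; 6 leaves slack. The last claim confines \<open>z\<close> to a disk determined
  by \<open>\<zeta>\<close> alone, ready for exchanging the integrals.\<close>

lemma half_distance_disk:
  fixes z \<zeta> :: complex
  assumes z: "cmod z < 1" and \<zeta>: "\<zeta> \<in> ball z ((1 - cmod z) / 2)"
  shows "cmod \<zeta> < 1"
    and "1 - (cmod z)\<^sup>2 \<le> 6 * (1 - (cmod \<zeta>)\<^sup>2)"
    and "1 - (cmod \<zeta>)\<^sup>2 \<le> 6 * (1 - (cmod z)\<^sup>2)"
    and "dist z \<zeta> < 2 * (1 - (cmod \<zeta>)\<^sup>2)"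
proof -
  have d: "cmod (z - \<zeta>) < (1 - cmod z) / 2" using \<zeta> by (simp add: dist_norm)
  have t: "cmod \<zeta> \<le> cmod z + cmod (z - \<zeta>)" "cmod z \<le> cmod \<zeta> + cmod (z - \<zeta>)"
    using norm_triangle_sub[of \<zeta> z] norm_triangle_sub[of z \<zeta>] by (simp_all add: norm_minus_commute)
  then show \<zeta>1: "cmod \<zeta> < 1" using d by simp
  have low: "1 - cmod x \<le> 1 - (cmod x)\<^sup>2" and up: "1 - (cmod x)\<^sup>2 \<le> 2 * (1 - cmod x)"
    if "cmod x < 1" for x :: complex
    using that mult_left_mono[of "cmod x" 1 "cmod x"] zero_le_power2[of "1 - cmod x"]
    by (simp_all add: power2_eq_square algebra_simps)
  have half: "1 - cmod z \<le> 2 * (1 - cmod \<zeta>)" "1 - cmod \<zeta> \<le> 2 * (1 - cmod z)"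
    using d t by (simp_all add: field_simps)
  have comp: "1 - (cmod x)\<^sup>2 \<le> 6 * (1 - (cmod y)\<^sup>2)"
    if x: "cmod x < 1" and y: "cmod y < 1" and xy: "1 - cmod x \<le> 2 * (1 - cmod y)" for x y :: complex
  proof -
    have "1 - (cmod x)\<^sup>2 \<le> 2 * (1 - cmod x)" by (rule up[OF x])
    also have "\<dots> \<le> 2 * (2 * (1 - cmod y))" by (intro mult_left_mono xy) simp
    also have "\<dots> \<le> 2 * (2 * (1 - (cmod y)\<^sup>2))" by (intro mult_left_mono low[OF y]) simp_all
    also have "\<dots> = 4 * (1 - (cmod y)\<^sup>2)" by simp
    also have "\<dots> \<le> 6 * (1 - (cmod y)\<^sup>2)" using low[OF y] y by (intro mult_right_mono) simp_all
    finally show ?thesis .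
  qed
  show "1 - (cmod z)\<^sup>2 \<le> 6 * (1 - (cmod \<zeta>)\<^sup>2)" "1 - (cmod \<zeta>)\<^sup>2 \<le> 6 * (1 - (cmod z)\<^sup>2)"
    using comp z \<zeta>1 half by blast+
  show "dist z \<zeta> < 2 * (1 - (cmod \<zeta>)\<^sup>2)" using d half(1) low[OF \<zeta>1] \<zeta>1 by (simp add: dist_norm)
qed

text \<open>The weight exponents \<open>p - 2\<close> and \<open>p - 4\<close> can be negative, so
  the comparison is needed in both directions: one serves \<open>s \<ge> 0\<close>, the other
  \<open>s < 0\<close>.\<close>

lemma powr_comparable:
  fixes x y c s :: real
  assumes x: "0 < x" and y: "0 < y" and "x \<le> c * y" "y \<le> c * x"
  shows "x powr s \<le> c powr \<bar>s\<bar> * y powr s"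
proof -
  have c: "0 < c" using assms by (smt (verit) mult_nonpos_nonneg)
  show ?thesis
  proof (cases "0 \<le> s")
    case True
    then have "x powr s \<le> (c * y) powr s" using assms by (intro powr_mono2) auto
    then show ?thesis using True by (simp add: powr_mult)
  next
    case False
    then have "x powr s \<le> (y / c) powr s"
      using assms c by (intro powr_mono2') (auto simp: field_simps)
    then show ?thesis using False by (simp add: powr_divide powr_minus field_simps)
  qed
qed

text \<open>The sum is at most four times its largest term, whose power is among the
  summands.\<close>

lemma four_term_powr_le:
  fixes a b c d p :: real
  assumes "0 \<le> p" "0 \<le> a" "0 \<le> b" "0 \<le> c" "0 \<le> d"
  shows "(a + b + c + d) powr p \<le> 4 powr p * (a powr p + b powr p + c powr p + d powr p)"
proof -
  define m where "m = max (max a b) (max c d)"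
  have "(a + b + c + d) powr p \<le> (4 * m) powr p"
    using assms by (intro powr_mono2) (auto simp: m_def)
  also have "\<dots> = 4 powr p * m powr p" by (simp add: powr_mult)
  also have "m powr p \<le> a powr p + b powr p + c powr p + d powr p"
    unfolding m_def max_def by auto
  finally show ?thesis by simp
qed

section \<open>Weighted integrals over the disk: pointwise bounds and derivatives\<close>

text \<open>The \<open>p\<close>-th power of a weighted Bergman norm. With \<open>s = p - 2\<close>
  and \<open>deriv u\<close> it is the integral in \<open>analytic_besov\<close>; with
  \<open>s = 2 * p - 2\<close> and the Schwarzian it is \<open>I(f)\<close>.\<close>

definition disk_integral :: "real \<Rightarrow> real \<Rightarrow> (complex \<Rightarrow> complex) \<Rightarrow> ennreal" where
  "disk_integral p s u = set_nn_integral lborel unit_disk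
     (\<lambda>z. ennreal (cmod (u z) powr p * (1 - (cmod z)\<^sup>2) powr s))"

lemma one_minus_cmod_sq_pos: "z \<in> unit_disk \<Longrightarrow> 0 < 1 - (cmod z)\<^sup>2"
  by (simp add: power_less_one_iff abs_square_less_1)

lemma borel_measurable_disk_integrand:
  assumes "continuous_on unit_disk u"
  shows "(\<lambda>z. ennreal (cmod (u z) powr p * (1 - (cmod z)\<^sup>2) powr s) * indicator unit_disk z)
    \<in> borel_measurable borel"
proof -
  have "(\<lambda>z. ennreal (cmod (u z) powr p) * indicator unit_disk z * ennreal ((1 - (cmod z)\<^sup>2) powr s))
    \<in> borel_measurable borel"
    by (intro borel_measurable_times_ennreal borel_measurable_powr_norm_indicator assms) auto
  then show ?thesis by (simp add: ennreal_mult mult_ac)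
qed

text \<open>The weight is comparable to its value at the centre throughout the small disk, so it can
  be inserted at the cost of a constant before enlarging the domain.\<close>

lemma local_integral_le_disk_integral:
  assumes hol: "u holomorphic_on unit_disk" and z: "z \<in> unit_disk"
  shows "(\<integral>\<^sup>+ \<zeta>\<in>ball z ((1 - cmod z) / 2). ennreal (cmod (u \<zeta>) powr p) \<partial>lborel)
    \<le> ennreal (6 powr \<bar>s\<bar> * (1 - (cmod z)\<^sup>2) powr (- s)) * disk_integral p s u" (is "?L \<le> _")
proof -
  let ?c = "6 powr \<bar>s\<bar> * (1 - (cmod z)\<^sup>2) powr (- s)"
  have "?L \<le> (\<integral>\<^sup>+ \<zeta>. ennreal ?c *
    (ennreal (cmod (u \<zeta>) powr p * (1 - (cmod \<zeta>)\<^sup>2) powr s) * indicator unit_disk \<zeta>) \<partial>lborel)"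
  proof (rule nn_integral_mono)
    fix \<zeta>
    show "ennreal (cmod (u \<zeta>) powr p) * indicator (ball z ((1 - cmod z) / 2)) \<zeta>
      \<le> ennreal ?c * (ennreal (cmod (u \<zeta>) powr p * (1 - (cmod \<zeta>)\<^sup>2) powr s) * indicator unit_disk \<zeta>)"
    proof (cases "\<zeta> \<in> ball z ((1 - cmod z) / 2)")
      case True
      have z1: "cmod z < 1" using z by simp
      note g = half_distance_disk[OF z1 True]
      have pos: "0 < 1 - (cmod \<zeta>)\<^sup>2" "0 < 1 - (cmod z)\<^sup>2"
        using g(1) z one_minus_cmod_sq_pos by simp_all
      have "1 = (1 - (cmod \<zeta>)\<^sup>2) powr (- s) * (1 - (cmod \<zeta>)\<^sup>2) powr s"
        using pos by (simp flip: powr_add)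
      also have "\<dots> \<le> 6 powr \<bar>- s\<bar> * (1 - (cmod z)\<^sup>2) powr (- s) * (1 - (cmod \<zeta>)\<^sup>2) powr s"
        by (intro mult_right_mono powr_comparable pos g) auto
      finally have "1 \<le> ?c * (1 - (cmod \<zeta>)\<^sup>2) powr s" by simp
      from mult_left_mono[OF this, of "cmod (u \<zeta>) powr p"]
      have "cmod (u \<zeta>) powr p \<le> ?c * (cmod (u \<zeta>) powr p * (1 - (cmod \<zeta>)\<^sup>2) powr s)"
        by (simp add: mult_ac)
      then show ?thesis
        using True g(1) by (simp flip: ennreal_mult)
    qed simp
  qed
  also have "\<dots> = ennreal ?c * disk_integral p s u"
    unfolding disk_integral_def
    by (intro nn_integral_cmult) (simp add: borel_measurable_disk_integrand[OF holomorphic_on_imp_continuous_on[OF hol]])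
  finally show ?thesis .
qed

text \<open>With \<open>d = 1 - |z|^2\<close>, the disk mean over a radius of size about
  \<open>d\<close> gives \<open>d^2 |u|^p\<close> at most a constant times
  \<open>d powr (2 - p)\<close>, that is, \<open>(d |u|)^p\<close> is bounded.\<close>

lemma weighted_sup_bounded:
  assumes hol: "u holomorphic_on unit_disk" and p: "1 < p" and fin: "disk_integral p (p - 2) u < \<infinity>"
  obtains M where "0 \<le> M" "\<And>z. z \<in> unit_disk \<Longrightarrow> (1 - (cmod z)\<^sup>2) * cmod (u z) \<le> M"
proof -
  define I where "I = enn2real (disk_integral p (p - 2) u)"
  have I: "disk_integral p (p - 2) u = ennreal I" "0 \<le> I"
    using fin by (simp_all add: I_def)
  \<comment> \<open>The 16 comes from bounding the disk area below by
    \<open>pi * (d / 4)^2\<close>.\<close>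
  define M where "M = (16 / pi * 6 powr \<bar>p - 2\<bar> * I) powr (1 / p)"
  have "(1 - (cmod z)\<^sup>2) * cmod (u z) \<le> M" if z: "z \<in> unit_disk" for z
  proof -
    define r where "r = (1 - cmod z) / 2"
    define d where "d = 1 - (cmod z)\<^sup>2"
    have r: "0 < r" using z by (simp add: r_def)
    have d: "0 < d" using one_minus_cmod_sq_pos[OF z] by (simp add: d_def)
    \<comment> \<open>Since \<open>d = (1 - |z|) * (1 + |z|)\<close> and
      \<open>1 + |z| \<le> 2\<close>.\<close>
    have dr: "d \<le> 4 * r"
      using zero_le_power2[of "1 - cmod z"] by (simp add: d_def r_def power2_eq_square algebra_simps)
    have sub: "ball z r \<subseteq> unit_disk"
      using half_distance_disk(1)[of z] z by (auto simp: r_def)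
    have "ennreal (pi * r\<^sup>2) * ennreal (cmod (u z) powr p)
      \<le> (\<integral>\<^sup>+ \<zeta>\<in>ball z r. ennreal (cmod (u \<zeta>) powr p) \<partial>lborel)"
      using p by (intro powr_norm_le_disk_mean holomorphic_on_subset[OF hol sub] r) simp
    also have "\<dots> \<le> ennreal (6 powr \<bar>p - 2\<bar> * d powr (- (p - 2))) * ennreal I"
      unfolding r_def d_def I(1)[symmetric] by (rule local_integral_le_disk_integral[OF hol z])
    finally have "pi * r\<^sup>2 * cmod (u z) powr p \<le> 6 powr \<bar>p - 2\<bar> * d powr (- (p - 2)) * I"
      using I(2) by (simp flip: ennreal_mult)
    moreover have "pi * (d / 4)\<^sup>2 * cmod (u z) powr p \<le> pi * r\<^sup>2 * cmod (u z) powr p"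
      using dr d by (intro mult_right_mono mult_left_mono power_mono) auto
    ultimately have "pi * (d / 4)\<^sup>2 * cmod (u z) powr p \<le> 6 powr \<bar>p - 2\<bar> * d powr (- (p - 2)) * I"
      by (rule order_trans[rotated])
    \<comment> \<open>This factor removes the power of \<open>d\<close> on the right and completes
      \<open>d^2\<close> to \<open>d powr p\<close> on the left.\<close>
    then have "d powr (p - 2) * (pi * (d / 4)\<^sup>2 * cmod (u z) powr p)
      \<le> d powr (p - 2) * (6 powr \<bar>p - 2\<bar> * d powr (- (p - 2)) * I)"
      by (rule mult_left_mono) simp
    also have "\<dots> = (d powr (p - 2) * d powr (- (p - 2))) * (6 powr \<bar>p - 2\<bar> * I)" by simp
    also have "d powr (p - 2) * d powr (- (p - 2)) = 1" using d by (simp flip: powr_add)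
    also have "d powr (p - 2) * (pi * (d / 4)\<^sup>2 * cmod (u z) powr p)
      = pi / 16 * (d powr (p - 2) * d powr 2 * cmod (u z) powr p)"
      using d by (simp add: power2_eq_square powr_numeral)
    also have "d powr (p - 2) * d powr 2 * cmod (u z) powr p = (d * cmod (u z)) powr p"
      by (simp add: powr_mult flip: powr_add)
    finally have "(d * cmod (u z)) powr p \<le> 16 / pi * 6 powr \<bar>p - 2\<bar> * I"
      by (simp add: field_simps)
    then have "((d * cmod (u z)) powr p) powr (1 / p) \<le> M"
      unfolding M_def using p by (intro powr_mono2) auto
    then show ?thesis using p d by (simp add: powr_powr d_def)
  qed
  moreover have "0 \<le> M" by (simp add: M_def)
  ultimately show thesis using that by blast
qed

text \<open>Bookkeeping of exponents: the derivative estimate contributes \<open>-2 - p\<close>,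
  which lowers \<open>2 * p - 2\<close> to \<open>p - 4\<close>; exchanging the integrals then
  contributes the area of a disk of radius proportional to the weight, which raises
  \<open>p - 4\<close> to \<open>p - 2\<close>.\<close>

lemma disk_integral_deriv_finite:
  assumes hol: "u holomorphic_on unit_disk" and p: "1 < p" and fin: "disk_integral p (p - 2) u < \<infinity>"
  shows "disk_integral p (2 * p - 2) (deriv u) < \<infinity>"
proof -
  \<comment> \<open>The factors come from the derivative estimate, from
    \<open>r \<ge> d / 4\<close>, and from moving the weight from \<open>z\<close> to
    \<open>\<zeta>\<close>.\<close>
  define K where "K = 4 * 2 powr p / pi * 4 powr (2 + p) * 6 powr \<bar>p - 4\<bar>"
  define \<Phi> where "\<Phi> \<zeta> = ennreal (cmod (u \<zeta>) powr p * (1 - (cmod \<zeta>)\<^sup>2) powr (p - 4)) * indicator unit_disk \<zeta>" for \<zeta>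
  \<comment> \<open>For \<open>z\<close> in the disk, \<open>A\<close> contains every pair with
    \<open>\<zeta>\<close> in the small disk about \<open>z\<close>. It is open, hence measurable in
    the product, and its sections at fixed \<open>\<zeta>\<close> are balls.\<close>
  define A :: "(complex \<times> complex) set" where "A = {(z, \<zeta>). dist z \<zeta> < 2 * (1 - (cmod \<zeta>)\<^sup>2)}"
  have \<Phi>[measurable]: "\<Phi> \<in> borel_measurable borel"
    unfolding \<Phi>_def by (rule borel_measurable_disk_integrand[OF holomorphic_on_imp_continuous_on[OF hol]])
  have "open A"
    unfolding A_def case_prod_beta by (intro open_Collect_less continuous_intros)
  then have [measurable]: "A \<in> sets (borel \<Otimes>\<^sub>M borel)"
    using borel_open unfolding borel_prod by blast
  have K: "0 \<le> K" by (simp add: K_def)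
  have pt: "ennreal (cmod (deriv u z) powr p * (1 - (cmod z)\<^sup>2) powr (2 * p - 2)) * indicator unit_disk z
      \<le> ennreal K * (\<integral>\<^sup>+ \<zeta>. \<Phi> \<zeta> * indicator A (z, \<zeta>) \<partial>lborel)" for z
  proof (cases "z \<in> unit_disk")
    case z: True
    define r where "r = (1 - cmod z) / 2"
    define d where "d = 1 - (cmod z)\<^sup>2"
    have r: "0 < r" using z by (simp add: r_def)
    have d: "0 < d" using one_minus_cmod_sq_pos[OF z] by (simp add: d_def)
    have dr: "d \<le> 4 * r"
      using zero_le_power2[of "1 - cmod z"] by (simp add: d_def r_def power2_eq_square algebra_simps)
    have z1: "cmod z < 1" using z by simp
    have sub: "ball z r \<subseteq> unit_disk"
      using half_distance_disk(1)[of z] z by (auto simp: r_def)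
    define K1 where "K1 = 4 * 2 powr p / pi * 4 powr (2 + p)"
    have K1: "0 \<le> K1" by (simp add: K1_def)
    have "r powr (- 2 - p) \<le> (d / 4) powr (- 2 - p)"
      using d dr p by (intro powr_mono2') auto
    also have "\<dots> = d powr (- 2 - p) * 4 powr (2 + p)"
      by (simp add: powr_divide powr_diff powr_minus powr_add field_simps)
    finally have "4 * 2 powr p / pi * r powr (- 2 - p) \<le> K1 * d powr (- 2 - p)"
      unfolding K1_def by (simp add: field_simps)
    then have "ennreal (cmod (deriv u z) powr p)
      \<le> ennreal (K1 * d powr (- 2 - p)) * (\<integral>\<^sup>+ \<zeta>\<in>ball z r. ennreal (cmod (u \<zeta>) powr p) \<partial>lborel)"
      using p by (intro order_trans[OF powr_norm_deriv_le_disk_mean[OF holomorphic_on_subset[OF hol sub] r]]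
          mult_right_mono ennreal_leI) auto
    then have "ennreal (cmod (deriv u z) powr p) * ennreal (d powr (2 * p - 2))
      \<le> ennreal (K1 * d powr (- 2 - p)) * (\<integral>\<^sup>+ \<zeta>\<in>ball z r. ennreal (cmod (u \<zeta>) powr p) \<partial>lborel)
        * ennreal (d powr (2 * p - 2))"
      by (rule mult_right_mono) simp
    also have "\<dots> = ennreal (K1 * (d powr (- 2 - p) * d powr (2 * p - 2)))
        * (\<integral>\<^sup>+ \<zeta>\<in>ball z r. ennreal (cmod (u \<zeta>) powr p) \<partial>lborel)"
      using K1 by (simp add: ennreal_mult mult_ac)
    also have "d powr (- 2 - p) * d powr (2 * p - 2) = d powr (p - 4)"
      by (simp flip: powr_add)
    also have "ennreal (K1 * d powr (p - 4)) * (\<integral>\<^sup>+ \<zeta>\<in>ball z r. ennreal (cmod (u \<zeta>) powr p) \<partial>lborel)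
      = (\<integral>\<^sup>+ \<zeta>. ennreal (K1 * d powr (p - 4)) * (ennreal (cmod (u \<zeta>) powr p) * indicator (ball z r) \<zeta>) \<partial>lborel)"
      by (intro nn_integral_cmult[symmetric])
         (simp add: borel_measurable_powr_norm_indicator holomorphic_on_imp_continuous_on holomorphic_on_subset[OF hol sub])
    also have "\<dots> \<le> (\<integral>\<^sup>+ \<zeta>. ennreal K * (\<Phi> \<zeta> * indicator A (z, \<zeta>)) \<partial>lborel)"
    proof (rule nn_integral_mono)
      fix \<zeta>
      show "ennreal (K1 * d powr (p - 4)) * (ennreal (cmod (u \<zeta>) powr p) * indicator (ball z r) \<zeta>)
        \<le> ennreal K * (\<Phi> \<zeta> * indicator A (z, \<zeta>))"
      proof (cases "\<zeta> \<in> ball z r")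
        case True
        note g = half_distance_disk[OF z1 True[unfolded r_def], folded d_def]
        have pos: "0 < 1 - (cmod \<zeta>)\<^sup>2" using g(1) one_minus_cmod_sq_pos by simp
        have "d powr (p - 4) \<le> 6 powr \<bar>p - 4\<bar> * (1 - (cmod \<zeta>)\<^sup>2) powr (p - 4)"
          by (intro powr_comparable d pos g)
        then have "K1 * d powr (p - 4) * cmod (u \<zeta>) powr p
          \<le> K1 * (6 powr \<bar>p - 4\<bar> * (1 - (cmod \<zeta>)\<^sup>2) powr (p - 4)) * cmod (u \<zeta>) powr p"
          using K1 by (intro mult_right_mono mult_left_mono) auto
        then show ?thesis
          using True g(1,4) K K1 sub by (simp add: \<Phi>_def A_def K_def K1_def mult_ac flip: ennreal_mult)
      qed simp
    qed
    also have "\<dots> = ennreal K * (\<integral>\<^sup>+ \<zeta>. \<Phi> \<zeta> * indicator A (z, \<zeta>) \<partial>lborel)"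
      by (rule nn_integral_cmult) measurable
    finally show ?thesis
      using z by (simp add: d_def ennreal_mult)
  qed simp
  \<comment> \<open>For \<open>\<zeta>\<close> in the disk the section of \<open>A\<close> is a ball
    of radius \<open>2 * d\<close>, with area \<open>4 * pi * d^2\<close>. It may leave the unit
    disk, which only enlarges the upper bound.\<close>
  have inner: "(\<integral>\<^sup>+ z. \<Phi> \<zeta> * indicator A (z, \<zeta>) \<partial>lborel)
    = ennreal (4 * pi) * (ennreal (cmod (u \<zeta>) powr p * (1 - (cmod \<zeta>)\<^sup>2) powr (p - 2)) * indicator unit_disk \<zeta>)" for \<zeta>
  proof (cases "\<zeta> \<in> unit_disk")
    case True
    define d where "d = 1 - (cmod \<zeta>)\<^sup>2"
    have d: "0 < d" using one_minus_cmod_sq_pos[OF True] by (simp add: d_def)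
    have "(\<integral>\<^sup>+ z. \<Phi> \<zeta> * indicator A (z, \<zeta>) \<partial>lborel) = (\<integral>\<^sup>+ z. \<Phi> \<zeta> * indicator (ball \<zeta> (2 * d)) z \<partial>lborel)"
      by (intro nn_integral_cong) (auto simp: A_def d_def indicator_def dist_commute)
    also have "\<dots> = \<Phi> \<zeta> * emeasure lborel (ball \<zeta> (2 * d))"
      by (intro nn_integral_cmult_indicator) auto
    also have "\<dots> = ennreal (cmod (u \<zeta>) powr p * d powr (p - 4)) * ennreal (pi * (2 * d)\<^sup>2)"
      using True d by (simp add: \<Phi>_def emeasure_ball unit_ball_vol_2 d_def)
    also have "\<dots> = ennreal (4 * pi * (cmod (u \<zeta>) powr p * (d powr (p - 4) * d powr 2)))"
      using d by (simp add: power2_eq_square powr_numeral mult_ac flip: ennreal_mult)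
    also have "d powr (p - 4) * d powr 2 = d powr (p - 2)"
      by (simp flip: powr_add)
    finally show ?thesis using True by (simp add: d_def ennreal_mult)
  qed (simp add: \<Phi>_def)
  have "disk_integral p (2 * p - 2) (deriv u)
    \<le> (\<integral>\<^sup>+ z. ennreal K * (\<integral>\<^sup>+ \<zeta>. \<Phi> \<zeta> * indicator A (z, \<zeta>) \<partial>lborel) \<partial>lborel)"
    unfolding disk_integral_def by (rule nn_integral_mono) (rule pt)
  also have "\<dots> = ennreal K * (\<integral>\<^sup>+ z. (\<integral>\<^sup>+ \<zeta>. \<Phi> \<zeta> * indicator A (z, \<zeta>) \<partial>lborel) \<partial>lborel)"
    by (rule nn_integral_cmult) measurable
  also have "(\<integral>\<^sup>+ z. (\<integral>\<^sup>+ \<zeta>. \<Phi> \<zeta> * indicator A (z, \<zeta>) \<partial>lborel) \<partial>lborel)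
    = (\<integral>\<^sup>+ \<zeta>. (\<integral>\<^sup>+ z. \<Phi> \<zeta> * indicator A (z, \<zeta>) \<partial>lborel) \<partial>lborel)"
    by (rule lborel_pair.Fubini'[symmetric]) measurable
  also have "\<dots> = ennreal (4 * pi) * disk_integral p (p - 2) u"
    unfolding inner disk_integral_def
    by (intro nn_integral_cmult) (simp add: borel_measurable_disk_integrand[OF holomorphic_on_imp_continuous_on[OF hol]])
  finally show ?thesis
    using fin by (simp add: ennreal_mult_less_top less_top order_le_less_trans)
qed

section \<open>The Wirtinger derivative of \<open>log J\<close>\<close>

text \<open>For holomorphic \<open>k\<close> the \<open>z\<close>-derivative of \<open>|k|^2\<close>
  is \<open>cnj k * k'\<close>, so \<open>F\<^sub>z = (cnj h' * h'' - cnj g' * g'') / J\<close>;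
  substituting \<open>g' = w * h'\<close> gives the stated form.\<close>

lemma wirt_z_log_jacobian:
  assumes sp: "sense_pres_harmonic h g" and z: "z \<in> unit_disk"
  shows "wirt_z (\<lambda>z. complex_of_real (ln (jacobian h g z))) z
    = deriv (deriv h) z / deriv h z
      - cnj (dilatation h g z) * deriv (dilatation h g) z / (1 - (cmod (dilatation h g z))\<^sup>2)"
proof -
  have hol: "h holomorphic_on unit_disk" "g holomorphic_on unit_disk"
    and h0: "deriv h z \<noteq> 0" and lt: "cmod (deriv g z) < cmod (deriv h z)"
    using sp z by (auto simp: sense_pres_harmonic_def)
  define h1 h2 g1 g2 where "h1 = deriv h z" and "h2 = deriv (deriv h) z"
    and "g1 = deriv g z" and "g2 = deriv (deriv g) z"
  define J where "J = (cmod h1)\<^sup>2 - (cmod g1)\<^sup>2"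
  have h1: "h1 \<noteq> 0" using h0 by (simp add: h1_def)
  have J: "0 < J"
    using lt by (simp add: J_def h1_def g1_def power_strict_mono)
  have dh: "(deriv h has_field_derivative h2) (at z)" and dg: "(deriv g has_field_derivative g2) (at z)"
    unfolding h2_def g2_def using z hol
    by (auto intro!: holomorphic_derivI[of _ unit_disk] holomorphic_deriv)
  have dJ: "(jacobian h g has_derivative (\<lambda>v. 2 * Re (cnj h1 * h2 * v) - 2 * Re (cnj g1 * g2 * v))) (at z)"
  proof -
    have sq: "((\<lambda>x. (cmod (k x))\<^sup>2) has_derivative (\<lambda>v. 2 * Re (cnj (k z) * k' * v))) (at z)"
      if k: "(k has_field_derivative k') (at z)" for k k'
    proof -
      have "(k has_derivative (\<lambda>v. k' * v)) (at z)"
        using k by (simp add: has_field_derivative_def)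
      then have "((\<lambda>x. k x \<bullet> k x) has_derivative (\<lambda>v. k z \<bullet> (k' * v) + (k' * v) \<bullet> k z)) (at z)"
        by (intro has_derivative_inner)
      then show ?thesis
        by (simp add: power2_norm_eq_inner inner_complex_def algebra_simps)
    qed
    show ?thesis
      unfolding jacobian_def[abs_def] h1_def g1_def
      by (intro has_derivative_diff sq dh dg)
  qed
  have "((\<lambda>x. complex_of_real (ln (jacobian h g x))) has_derivative
    (\<lambda>v. complex_of_real (inverse J * (2 * Re (cnj h1 * h2 * v) - 2 * Re (cnj g1 * g2 * v))))) (at z)"
  proof (rule has_derivative_of_real)
    have "(ln has_derivative (\<lambda>y. inverse J * y)) (at (jacobian h g z))"
      using has_derivative_ln[of "\<lambda>x. x" J "\<lambda>x. x" UNIV] J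
      by (simp add: jacobian_def J_def h1_def g1_def mult.commute)
    from diff_chain_at[OF dJ this]
    show "((\<lambda>x. ln (jacobian h g x)) has_derivative
      (\<lambda>v. inverse J * (2 * Re (cnj h1 * h2 * v) - 2 * Re (cnj g1 * g2 * v)))) (at z)"
      by (simp add: o_def)
  qed
  then have fd: "frechet_derivative (\<lambda>x. complex_of_real (ln (jacobian h g x))) (at z)
    = (\<lambda>v. complex_of_real (inverse J * (2 * Re (cnj h1 * h2 * v) - 2 * Re (cnj g1 * g2 * v))))"
    by (rule frechet_derivative_at[symmetric])
  \<comment> \<open>The real-linear map \<open>v \<mapsto> 2 * Re (c * v)\<close> has
    \<open>z\<close>-Wirtinger coefficient \<open>c\<close>.\<close>
  have wirt: "wirt_z (\<lambda>z. complex_of_real (ln (jacobian h g z))) z = (cnj h1 * h2 - cnj g1 * g2) / J"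
    by (simp add: wirt_z_def partial_x_def partial_y_def fd complex_eq_iff)
       (use J in \<open>simp add: divide_simps\<close>, simp add: algebra_simps power2_eq_square)
  have dw: "deriv (dilatation h g) z = (g2 * h1 - g1 * h2) / (h1 * h1)"
    unfolding dilatation_def[abs_def] h1_def g1_def
    by (intro DERIV_imp_deriv DERIV_divide dg dh h0)
  have w: "dilatation h g z = g1 / h1" by (simp add: dilatation_def g1_def h1_def)
  have cJ: "complex_of_real J = h1 * cnj h1 - g1 * cnj g1"
    by (simp add: J_def flip: complex_norm_square)
  \<comment> \<open>This is \<open>J = |h'|^2 * (1 - |w|^2)\<close>, which puts both sides over
    powers of \<open>h1\<close> and \<open>J\<close>.\<close>
  have one: "complex_of_real (1 - (cmod (g1 / h1))\<^sup>2) = J / (h1 * cnj h1)"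
    using h1 by (simp add: J_def norm_divide power_divide diff_divide_distrib flip: complex_norm_square)
  have J': "complex_of_real J \<noteq> 0" using J by simp
  show ?thesis
    unfolding wirt dw w one h2_def[symmetric] h1_def[symmetric]
    using h1 J' cJ by (simp add: divide_simps) (simp add: algebra_simps)
qed

section \<open>Bounds for the pre-Schwarzian and the Schwarzian by domination\<close>

text \<open>The exponent \<open>k p - 2\<close> is that of \<open>|(1 - |z|^2)^k u|^p\<close> against the hyperbolic area.\<close>
lemma disk_integral_dominated:
  assumes p: "0 \<le> p" and C: "0 \<le> C"
    and cont: "continuous_on unit_disk a" "continuous_on unit_disk b"
      "continuous_on unit_disk c" "continuous_on unit_disk d"
    and fin: "disk_integral p (real k * p - 2) a < \<infinity>" "disk_integral p (real l * p - 2) b < \<infinity>"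
      "disk_integral p (real m * p - 2) c < \<infinity>" "disk_integral p (real n * p - 2) d < \<infinity>"
    and dom: "\<And>z. z \<in> unit_disk \<Longrightarrow> (1 - (cmod z)\<^sup>2) ^ j * cmod (S z) \<le>
      C * ((1 - (cmod z)\<^sup>2) ^ k * cmod (a z) + (1 - (cmod z)\<^sup>2) ^ l * cmod (b z)
        + (1 - (cmod z)\<^sup>2) ^ m * cmod (c z) + (1 - (cmod z)\<^sup>2) ^ n * cmod (d z))"
  shows "disk_integral p (real j * p - 2) S < \<infinity>"
proof -
  define K where "K = C powr p * 4 powr p"
  define f where "f i u z = ennreal (cmod (u z) powr p * (1 - (cmod z)\<^sup>2) powr (real i * p - 2)) * indicator unit_disk z"
    for i z and u :: "complex \<Rightarrow> complex"
  have K: "0 \<le> K" by (simp add: K_def)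
  have pt: "f j S z \<le> ennreal K * (f k a z + f l b z + f m c z + f n d z)" for z
  proof (cases "z \<in> unit_disk")
    case True
    define t where "t = 1 - (cmod z)\<^sup>2"
    define q where "q i x = cmod x powr p * t powr (real i * p - 2)" for i :: nat and x :: complex
    have t: "0 < t" using one_minus_cmod_sq_pos[OF True] by (simp add: t_def)
    \<comment> \<open>The same factor \<open>t powr 2\<close> splits off whatever the order
      \<open>i\<close>, so it cancels from the final inequality.\<close>
    have q: "(t ^ i * cmod x) powr p = t powr 2 * q i x" for x and i :: nat
    proof -
      have "(t ^ i) powr p = t powr (real i * p)"
        using t by (simp add: powr_powr flip: powr_realpow)
      also have "\<dots> = t powr 2 * t powr (real i * p - 2)" by (simp flip: powr_add)
      finally show ?thesis by (simp add: powr_mult q_def mult_ac)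
    qed
    have "t powr 2 * q j (S z) = (t ^ j * cmod (S z)) powr p"
      by (rule q[symmetric])
    also have "\<dots> \<le> (C * (t ^ k * cmod (a z) + t ^ l * cmod (b z) + t ^ m * cmod (c z) + t ^ n * cmod (d z))) powr p"
      using dom[OF True] p t by (intro powr_mono2) (auto simp: t_def)
    also have "\<dots> = C powr p * (t ^ k * cmod (a z) + t ^ l * cmod (b z) + t ^ m * cmod (c z) + t ^ n * cmod (d z)) powr p"
      by (simp add: powr_mult)
    also have "\<dots> \<le> C powr p * (4 powr p * ((t ^ k * cmod (a z)) powr p + (t ^ l * cmod (b z)) powr p
        + (t ^ m * cmod (c z)) powr p + (t ^ n * cmod (d z)) powr p))"
      using p t by (intro mult_left_mono four_term_powr_le) auto
    also have "\<dots> = t powr 2 * (K * (q k (a z) + q l (b z) + q m (c z) + q n (d z)))"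
      unfolding q K_def by (simp add: algebra_simps)
    finally have "q j (S z) \<le> K * (q k (a z) + q l (b z) + q m (c z) + q n (d z))"
      using t by simp
    moreover have "f i u z = ennreal (q i (u z))" for i u
      using True by (simp add: f_def q_def t_def)
    moreover have "0 \<le> q i x" for i x by (simp add: q_def)
    ultimately show ?thesis
      using K by (simp flip: ennreal_mult ennreal_plus)
  qed (simp add: f_def)
  have meas [measurable]: "f i a \<in> borel_measurable borel" "f i b \<in> borel_measurable borel"
    "f i c \<in> borel_measurable borel" "f i d \<in> borel_measurable borel" for i
    unfolding f_def using cont by (auto intro: borel_measurable_disk_integrand)
  have "disk_integral p (real j * p - 2) S \<le> (\<integral>\<^sup>+ z. ennreal K * (f k a z + f l b z + f m c z + f n d z) \<partial>lborel)"
    unfolding disk_integral_def f_def[symmetric] by (intro nn_integral_mono pt)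
  also have "\<dots> = ennreal K * (disk_integral p (real k * p - 2) a + disk_integral p (real l * p - 2) b
    + disk_integral p (real m * p - 2) c + disk_integral p (real n * p - 2) d)"
    unfolding disk_integral_def f_def[symmetric]
    by (simp add: nn_integral_cmult nn_integral_add)
  also have "\<dots> < \<infinity>"
    using fin by (simp add: ennreal_mult_less_top)
  finally show ?thesis .
qed

lemma disk_integral_0 [simp]: "disk_integral p s (\<lambda>z. 0) = 0"
  by (simp add: disk_integral_def)

lemma holomorphic_pre_schwarzian:
  assumes "sense_pres_harmonic h g"
  shows "(\<lambda>z. deriv (deriv h) z / deriv h z) holomorphic_on unit_disk"
  using assms by (auto simp: sense_pres_harmonic_def intro!: holomorphic_intros holomorphic_deriv)

text \<open>Solving the formula for \<open>F\<^sub>z\<close> gives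
  \<open>\<phi> = F\<^sub>z + Q * w'\<close> with \<open>|Q| \<le> N\<close>, and both
  \<open>F\<^sub>z\<close> and \<open>w'\<close> have finite weighted integrals.\<close>

lemma pre_schwarzian_disk_integral_finite:
  assumes p: "1 < p" and sp: "sense_pres_harmonic h g"
    and w: "dilatation h g \<in> analytic_besov p"
    and N: "0 \<le> N" "\<And>z. z \<in> unit_disk \<Longrightarrow>
      cmod (cnj (dilatation h g z) / complex_of_real (1 - (cmod (dilatation h g z))\<^sup>2)) \<le> N"
    and w1: "\<And>z. z \<in> unit_disk \<Longrightarrow> cmod (dilatation h g z) < 1"
    and F: "(\<lambda>z. complex_of_real (ln (jacobian h g z))) \<in> smooth_besov p"
  shows "disk_integral p (p - 2) (\<lambda>z. deriv (deriv h) z / deriv h z) < \<infinity>"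
proof -
  define W where "W = dilatation h g"
  define F where "F z = complex_of_real (ln (jacobian h g z))" for z
  define \<phi> where "\<phi> z = deriv (deriv h) z / deriv h z" for z
  define Q where "Q z = cnj (W z) / complex_of_real (1 - (cmod (W z))\<^sup>2)" for z
  have holW: "W holomorphic_on unit_disk" using w by (simp add: W_def analytic_besov_def)
  have hol\<phi>: "\<phi> holomorphic_on unit_disk"
    unfolding \<phi>_def by (rule holomorphic_pre_schwarzian[OF sp])
  have Fz: "wirt_z F z = \<phi> z - Q z * deriv W z" if "z \<in> unit_disk" for z
    using wirt_z_log_jacobian[OF sp that] by (simp add: F_def[abs_def] \<phi>_def Q_def W_def)
  have W1: "1 - complex_of_real ((cmod (W z))\<^sup>2) \<noteq> 0" if "z \<in> unit_disk" for z
  proof -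
    have "(cmod (W z))\<^sup>2 < 1" using w1[OF that] by (simp add: W_def abs_square_less_1)
    then have "complex_of_real (1 - (cmod (W z))\<^sup>2) \<noteq> 0" unfolding of_real_eq_0_iff by simp
    then show ?thesis by simp
  qed
  \<comment> \<open>Continuity is read off from the explicit formula, which agrees with
    \<open>wirt_z F\<close> on the disk.\<close>
  have contFz: "continuous_on unit_disk (wirt_z F)"
  proof -
    have "continuous_on unit_disk (\<lambda>z. \<phi> z - Q z * deriv W z)"
      unfolding Q_def
      using W1 by (intro continuous_intros holomorphic_on_imp_continuous_on hol\<phi> holW holomorphic_deriv) auto
    then show ?thesis using Fz by (subst continuous_on_cong[OF refl Fz])
  qed
  have finF: "disk_integral p (p - 2) (wirt_z F) < \<infinity>"
  proof -
    have "disk_integral p (p - 2) (wirt_z F) \<le> set_nn_integral lborel unit_disk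
       (\<lambda>z. ennreal ((cmod (wirt_z F z) + cmod (wirt_zbar F z)) powr p
                     * (1 - (cmod z)\<^sup>2) powr (p - 2)))"
      unfolding disk_integral_def using p
      by (intro nn_integral_mono mult_right_mono ennreal_leI powr_mono2) auto
    then show ?thesis using F unfolding smooth_besov_def F_def[abs_def] by (auto intro: order_le_less_trans)
  qed
  have finW: "disk_integral p (p - 2) (deriv W) < \<infinity>"
    using w by (simp add: analytic_besov_def disk_integral_def W_def)
  have "disk_integral p (real 1 * p - 2) \<phi> < \<infinity>"
  \<comment> \<open>Order 1 gives the exponent \<open>p - 2\<close>; the two spare slots take the
    zero function.\<close>
  proof (rule disk_integral_dominated[where k=1 and l=1 and m=1 and n=1
        and a="wirt_z F" and b="deriv W" and c="\<lambda>_. 0" and d="\<lambda>_. 0" and C="1 + N"])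
    fix z assume z: "z \<in> unit_disk"
    define t where "t = 1 - (cmod z)\<^sup>2"
    have t: "0 < t" using one_minus_cmod_sq_pos[OF z] by (simp add: t_def)
    have "cmod (\<phi> z) = cmod (wirt_z F z + Q z * deriv W z)" using Fz[OF z] by simp
    also have "\<dots> \<le> cmod (wirt_z F z) + cmod (Q z) * cmod (deriv W z)"
      using norm_triangle_ineq by (metis norm_mult)
    also have "\<dots> \<le> cmod (wirt_z F z) + N * cmod (deriv W z)"
      using N(2)[OF z] by (intro add_left_mono mult_right_mono) (auto simp: Q_def W_def)
    also have "\<dots> \<le> (1 + N) * (cmod (wirt_z F z) + cmod (deriv W z))"
      using N(1) by (simp add: algebra_simps)
    finally have "t * cmod (\<phi> z) \<le> t * ((1 + N) * (cmod (wirt_z F z) + cmod (deriv W z)))"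
      using t by (intro mult_left_mono) auto
    then show "(1 - (cmod z)\<^sup>2) ^ 1 * cmod (\<phi> z) \<le> (1 + N) * ((1 - (cmod z)\<^sup>2) ^ 1 * cmod (wirt_z F z)
      + (1 - (cmod z)\<^sup>2) ^ 1 * cmod (deriv W z) + (1 - (cmod z)\<^sup>2) ^ 1 * cmod 0 + (1 - (cmod z)\<^sup>2) ^ 1 * cmod 0)"
      by (simp add: t_def algebra_simps)
  qed (use p N finF finW contFz holW in \<open>auto intro!: holomorphic_on_imp_continuous_on holomorphic_deriv\<close>)
  then show ?thesis by (simp add: \<phi>_def[abs_def])
qed

text \<open>Both terms involving \<open>w\<close> share the coefficient \<open>Q\<close>, bounded by
  \<open>N\<close>; the triangle inequality does the rest, with \<open>1/2\<close> rounded up to 1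
  and \<open>3/2\<close> up to 2.\<close>

lemma cmod_harmonic_schwarzian_le:
  assumes N: "0 \<le> N" "cmod (cnj (dilatation h g z) / complex_of_real (1 - (cmod (dilatation h g z))\<^sup>2)) \<le> N"
  defines "\<phi> \<equiv> \<lambda>z. deriv (deriv h) z / deriv h z"
  shows "cmod (harmonic_schwarzian h g z) \<le> cmod (deriv \<phi> z) + (cmod (\<phi> z))\<^sup>2
    + N * (cmod (deriv (dilatation h g) z) * cmod (\<phi> z) + cmod (deriv (deriv (dilatation h g)) z))
    + 2 * N\<^sup>2 * (cmod (deriv (dilatation h g) z))\<^sup>2"
proof -
  define W where "W = dilatation h g"
  define Q where "Q = cnj (W z) / complex_of_real (1 - (cmod (W z))\<^sup>2)"
  have Q: "cmod Q \<le> N" using N(2) by (simp add: Q_def W_def)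
  have "harmonic_schwarzian h g z = deriv \<phi> z - (1/2) * (\<phi> z)\<^sup>2
    + Q * (deriv W z * \<phi> z - deriv (deriv W) z) - (3/2) * (Q * deriv W z)\<^sup>2"
    by (simp add: harmonic_schwarzian_def classical_schwarzian_def W_def[symmetric] Q_def \<phi>_def Let_def mult_ac)
  also have "cmod \<dots> \<le> cmod (deriv \<phi> z) + cmod ((1/2) * (\<phi> z)\<^sup>2)
    + cmod (Q * (deriv W z * \<phi> z - deriv (deriv W) z)) + cmod ((3/2) * (Q * deriv W z)\<^sup>2)"
    by (intro order_trans[OF norm_triangle_ineq4] order_trans[OF norm_triangle_ineq]
        add_mono order_refl)
  also have "cmod ((1/2) * (\<phi> z)\<^sup>2) \<le> (cmod (\<phi> z))\<^sup>2"
    by (simp add: norm_mult norm_power)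
  also have "cmod (Q * (deriv W z * \<phi> z - deriv (deriv W) z))
    \<le> N * (cmod (deriv W z) * cmod (\<phi> z) + cmod (deriv (deriv W) z))"
    unfolding norm_mult[of Q] using N(1) Q
    by (intro mult_mono order_trans[OF norm_triangle_ineq4]) (auto simp: norm_mult)
  also have "cmod ((3/2) * (Q * deriv W z)\<^sup>2) \<le> 2 * N\<^sup>2 * (cmod (deriv W z))\<^sup>2"
  proof -
    have "(cmod Q)\<^sup>2 * (cmod (deriv W z))\<^sup>2 \<le> N\<^sup>2 * (cmod (deriv W z))\<^sup>2"
      using Q by (intro mult_right_mono power_mono) auto
    then have "3 / 2 * ((cmod Q)\<^sup>2 * (cmod (deriv W z))\<^sup>2) \<le> 2 * (N\<^sup>2 * (cmod (deriv W z))\<^sup>2)"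
      by (intro mult_mono[OF _ _ _ mult_nonneg_nonneg]) simp_all
    then show ?thesis by (simp add: norm_mult norm_power norm_divide power_mult_distrib)
  qed
  finally show ?thesis by (simp add: W_def)
qed

theorem theorem1:
  fixes p :: real and h g :: "complex \<Rightarrow> complex"
  assumes "1 < p"
    and "sense_pres_harmonic h g"
    and "uniformly_locally_univalent (\<lambda>z. h z + cnj (g z))"
    and "dilatation h g \<in> analytic_besov p"
    and "(SUP z\<in>unit_disk. cmod (dilatation h g z)) < 1"
    and "(\<lambda>z. complex_of_real (ln (jacobian h g z))) \<in> smooth_besov p"
  shows "set_nn_integral lborel unit_disk
           (\<lambda>z. ennreal (cmod (harmonic_schwarzian h g z) powr p
                         * (1 - (cmod z)\<^sup>2) powr (2 * p - 2))) < \<infinity>"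
proof -
  define W where "W = dilatation h g"
  define \<phi> where "\<phi> z = deriv (deriv h) z / deriv h z" for z
  define k where "k = (SUP z\<in>unit_disk. cmod (W z))"
  have W1: "cmod (W z) < 1" if "z \<in> unit_disk" for z
    using assms(2) that by (auto simp: sense_pres_harmonic_def W_def dilatation_def norm_divide)
  \<comment> \<open>The pointwise bound \<open>|W| < 1\<close> supplies the boundedness without
    which a real supremum says nothing.\<close>
  have Wk: "cmod (W z) \<le> k" if "z \<in> unit_disk" for z
    unfolding k_def using that W1 by (intro cSUP_upper bdd_aboveI2[of _ _ 1]) (auto intro: less_imp_le)
  have k: "0 \<le> k" "k < 1"
    using Wk[of 0] norm_ge_zero[of "W 0"] assms(5) by (auto simp: k_def W_def simp del: norm_ge_zero)
  \<comment> \<open>Since \<open>|W| \<le> k < 1\<close>, the numerator of the coefficient is at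
    most 1 and its denominator at least \<open>1 - k^2\<close>.\<close>
  define N where "N = 1 / (1 - k\<^sup>2)"
  have k2: "0 < 1 - k\<^sup>2" using k by (simp add: power_less_one_iff abs_square_less_1)
  have N: "0 \<le> N" using k2 by (simp add: N_def)
  have QN: "cmod (cnj (W z) / complex_of_real (1 - (cmod (W z))\<^sup>2)) \<le> N" if z: "z \<in> unit_disk" for z
  proof -
    have "1 - k\<^sup>2 \<le> 1 - (cmod (W z))\<^sup>2" using Wk[OF z] by (simp add: power_mono)
    then show ?thesis
      unfolding norm_divide N_def using k2 W1[OF z] by (intro frac_le) (auto simp del: of_real_diff)
  qed
  have holW: "deriv W holomorphic_on unit_disk"
    using assms(4) by (auto simp: W_def analytic_besov_def intro: holomorphic_deriv)
  have hol\<phi>: "\<phi> holomorphic_on unit_disk"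
    unfolding \<phi>_def by (rule holomorphic_pre_schwarzian[OF assms(2)])
  have fin\<phi>: "disk_integral p (p - 2) \<phi> < \<infinity>"
    unfolding \<phi>_def
    by (rule pre_schwarzian_disk_integral_finite[OF assms(1,2,4) N _ _ assms(6)])
       (use QN W1 in \<open>auto simp: W_def\<close>)
  have finW: "disk_integral p (p - 2) (deriv W) < \<infinity>"
    using assms(4) by (simp add: analytic_besov_def disk_integral_def W_def)
  obtain M1 where M1: "0 \<le> M1" "\<And>z. z \<in> unit_disk \<Longrightarrow> (1 - (cmod z)\<^sup>2) * cmod (\<phi> z) \<le> M1"
    using weighted_sup_bounded[OF hol\<phi> assms(1) fin\<phi>] by blast
  obtain M2 where M2: "0 \<le> M2" "\<And>z. z \<in> unit_disk \<Longrightarrow> (1 - (cmod z)\<^sup>2) * cmod (deriv W z) \<le> M2"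
    using weighted_sup_bounded[OF holW assms(1) finW] by blast
  \<comment> \<open>The sum of all coefficients in front of the four dominating terms, hence an
    upper bound for each.\<close>
  define C where "C = 1 + M1 + N + N * M1 + 2 * N\<^sup>2 * M2"
  have "disk_integral p (real 2 * p - 2) (harmonic_schwarzian h g) < \<infinity>"
  \<comment> \<open>Order 1 belongs to \<phi> and \<open>deriv W\<close>, order 2 to their
    derivatives.\<close>
  proof (rule disk_integral_dominated[where k=1 and l=2 and m=1 and n=2
        and a=\<phi> and b="deriv \<phi>" and c="deriv W" and d="deriv (deriv W)" and C=C])
    fix z assume z: "z \<in> unit_disk"
    define t where "t = 1 - (cmod z)\<^sup>2"
    have t: "0 < t" using one_minus_cmod_sq_pos[OF z] by (simp add: t_def)
    \<comment> \<open>The factor \<open>t ^ 2\<close> is spent once on a derivative, or as one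
      \<open>t\<close> on each factor of a quadratic term.\<close>
    define A B X Y where "A = t * cmod (\<phi> z)" and "B = t ^ 2 * cmod (deriv \<phi> z)"
      and "X = t * cmod (deriv W z)" and "Y = t ^ 2 * cmod (deriv (deriv W) z)"
    have nn: "0 \<le> A" "0 \<le> B" "0 \<le> X" "0 \<le> Y" using t by (auto simp: A_def B_def X_def Y_def)
    have AM: "A \<le> M1" and XM: "X \<le> M2" using M1(2)[OF z] M2(2)[OF z] by (auto simp: A_def X_def t_def)
    have "t ^ 2 * cmod (harmonic_schwarzian h g z) \<le> t ^ 2 * (cmod (deriv \<phi> z) + (cmod (\<phi> z))\<^sup>2
      + N * (cmod (deriv W z) * cmod (\<phi> z) + cmod (deriv (deriv W) z)) + 2 * N\<^sup>2 * (cmod (deriv W z))\<^sup>2)"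
      using cmod_harmonic_schwarzian_le[OF N QN[OF z, unfolded W_def]]
      by (intro mult_left_mono) (auto simp: \<phi>_def[abs_def] W_def)
    also have "\<dots> = B + A * A + N * (A * X) + N * Y + 2 * N\<^sup>2 * (X * X)"
      by (simp add: A_def B_def X_def Y_def algebra_simps power2_eq_square)
    \<comment> \<open>In each quadratic term one factor is replaced by its pointwise bound, leaving
      an expression linear in \<open>A\<close>, \<open>B\<close>, \<open>X\<close>,
      \<open>Y\<close>.\<close>
    also have "\<dots> \<le> B + M1 * A + N * (M1 * X) + N * Y + 2 * N\<^sup>2 * (M2 * X)"
      using nn N AM XM by (intro add_mono mult_left_mono mult_right_mono) auto
    also have "\<dots> = 1 * B + M1 * A + (N * M1 + 2 * N\<^sup>2 * M2) * X + N * Y"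
      by (simp add: algebra_simps)
    also have "\<dots> \<le> C * B + C * A + C * X + C * Y"
      using nn N M1(1) M2(1) by (intro add_mono mult_right_mono) (auto simp: C_def)
    finally show "(1 - (cmod z)\<^sup>2) ^ 2 * cmod (harmonic_schwarzian h g z) \<le> C * ((1 - (cmod z)\<^sup>2) ^ 1 * cmod (\<phi> z)
      + (1 - (cmod z)\<^sup>2) ^ 2 * cmod (deriv \<phi> z) + (1 - (cmod z)\<^sup>2) ^ 1 * cmod (deriv W z)
      + (1 - (cmod z)\<^sup>2) ^ 2 * cmod (deriv (deriv W) z))"
      by (simp add: A_def B_def X_def Y_def t_def algebra_simps)
  qed (use assms(1) fin\<phi> finW disk_integral_deriv_finite[OF hol\<phi> assms(1) fin\<phi>]
        disk_integral_deriv_finite[OF holW assms(1) finW] N M1(1) M2(1) hol\<phi> holW in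
      \<open>auto simp: C_def intro!: holomorphic_on_imp_continuous_on holomorphic_deriv\<close>)
  then show ?thesis by (simp add: disk_integral_def)
qed

end
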